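(* There exists an ACOPF instance on a two-bus network with standard line parameters and rational data, where the only two AC feasible solutions are irrational. Additionally, the unique minimizer of the Jabr SOCP of this instance is also irrational. Furthermore, the dual problem to this Jabr SOCP has a unique maximizer, which is irrational as well.
   Context: ACOPF (alternating-current optimal power flow). The input is a network with a set $\mathcal{B}$ of buses (nodes) and a set $\mathcal{E}$ of branches (edges, e.g. transmission lines), and a set $\mathcal{G}$ of generators, those located at bus $k$ forming $\mathcal{G}_k$. Each bus $k$ has an active load $P_k^d\ge 0$, a reactive load $Q_k^d$, and voltage limits $V_k^{\min},V_k^{\max}\ge 0$; each generator has lower and upper limits on its active output $P^g$ and reactive output $Q^g$, and a convex cost function $F$ of $P^g$; each branch $\{k,m\}$ has a limit $0\le U_{km}\le+\infty$ and a $2\times 2$ complex admittance matrix with entries $G_{kk}+jB_{kk}$, $G_{km}+jB_{km}$ (first row), $G_{mk}+jB_{mk}$, $G_{mm}+jB_{mm}$ (second row). The variables are the voltage magnitude $|V_k|$ and phase angle $\theta_k$ at each bus, the generator outputs, and the active and reactive flows $P_{km},P_{mk},Q_{km},Q_{mk}$ on each branch. The problem is to minimize the total generation cost $\sum_{k\in\mathcal{G}}F_k(P_k^g)$ subject to: - power balance at every bus $k$: $\sum_{\{k,m\}}P_{km}=\sum_{\ell\in\mathcal{G}_k}P_\ell^g-P_k^d$ and $\sum_{\{k,m\}}Q_{km}=\sum_{\ell\in\mathcal{G}_k}Q_\ell^g-Q_k^d$, the left-hand sums being over branches at $k$; - on every branch, with $V_k=|V_k|e^{j\theta_k}$, the power-flow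 equations $P_{km}+jQ_{km}=(G_{kk}-jB_{kk})|V_k|^2+(G_{km}-jB_{km})V_kV_m^*$ and $P_{mk}+jQ_{mk}=(G_{mm}-jB_{mm})|V_m|^2+(G_{mk}-jB_{mk})V_mV_k^*$; - the generator limits, $(V_k^{\min})^2\le|V_k|^2\le(V_k^{\max})^2$, the branch limits $\max\{P_{km}^2+Q_{km}^2,\,P_{mk}^2+Q_{mk}^2\}\le U_{km}$, and, if present (often they are not), limits on $|\theta_k-\theta_m|$. An AC feasible solution is a feasible solution of this problem; only angle differences enter the constraints. "Standard line parameters" is used informally: the line's electrical parameters are of the usual physical type, e.g. nonnegative conductance. The Jabr SOCP is the convex relaxation of ACOPF with additional variables $v_k^{(2)}$, $c_{km}$, $s_{km}$ standing for $|V_k|^2$, $|V_k||V_m|\cos(\theta_k-\theta_m)$, $|V_k||V_m|\sin(\theta_k-\theta_m)$. The power-flow equations are replaced by their linear form in these variables (substitute $|V_k|^2\to v_k^{(2)}$, $V_kV_m^*\to c_{km}+js_{km}$, $V_mV_k^*\to c_{km}-js_{km}$), the rotated-cone inequality $c_{km}^2+s_{km}^2\le v_k^{(2)}v_m^{(2)}$ is added for every branch, and the objective and the other constraints are kept. On a radial (tree) network, such as a two-bus network with one line, imposing this inequality as an equation gives an exact formulation of ACOPF. The dual problem is the Lagrangian dual of the Jabr SOCP. A solution is irrational if not all of its coordinates are rational. *)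

theory Defs
  imports "HOL-Analysis.Analysis"
begin

text \<open>
  Buses, branches and generators are the elements of the finite types \<open>'b\<close>, \<open>'e\<close>, \<open>'g\<close>, so that a
  solution is a tuple of total functions and equality of records is equality of solutions.
  A branch \<open>e\<close> joins \<open>k = src N e\<close> and \<open>m = dst N e\<close>; \<open>ykk\<close>, \<open>ykm\<close>, \<open>ymk\<close>, \<open>ymm\<close> are the
  entries \<open>G + jB\<close> of its admittance matrix. The value \<open>\<infinity>\<close> of \<open>ulim\<close> means that there is no
  branch limit. Limits on angle differences are optional in the problem and are not part of the
  instances considered here.
\<close>

record ('b, 'e, 'g) acopf =
  src :: "'e \<Rightarrow> 'b"
  dst :: "'e \<Rightarrow> 'b"
  ykk :: "'e \<Rightarrow> complex"
  ykm :: "'e \<Rightarrow> complex"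
  ymk :: "'e \<Rightarrow> complex"
  ymm :: "'e \<Rightarrow> complex"
  ulim :: "'e \<Rightarrow> ereal"
  pd :: "'b \<Rightarrow> real"
  qd :: "'b \<Rightarrow> real"
  vmin :: "'b \<Rightarrow> real"
  vmax :: "'b \<Rightarrow> real"
  gbus :: "'g \<Rightarrow> 'b"
  pmin :: "'g \<Rightarrow> real"
  pmax :: "'g \<Rightarrow> real"
  qmin :: "'g \<Rightarrow> real"
  qmax :: "'g \<Rightarrow> real"
  cost :: "'g \<Rightarrow> real \<Rightarrow> real"

definition acopf_instance :: "('b::finite, 'e::finite, 'g::finite) acopf \<Rightarrow> bool" where
  "acopf_instance N \<longleftrightarrow>
     (\<forall>e. src N e \<noteq> dst N e \<and> 0 \<le> ulim N e) \<and>
     (\<forall>k. 0 \<le> pd N k \<and> 0 \<le> vmin N k \<and> 0 \<le> vmax N k) \<and>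
     (\<forall>g. convex_on UNIV (cost N g))"

definition complex_rational :: "complex \<Rightarrow> bool" where
  "complex_rational z \<longleftrightarrow> Re z \<in> \<rat> \<and> Im z \<in> \<rat>"

text \<open>For a cost function, rational data means a polynomial with rational coefficients.\<close>

definition rational_data :: "('b::finite, 'e::finite, 'g::finite) acopf \<Rightarrow> bool" where
  "rational_data N \<longleftrightarrow>
     (\<forall>e. complex_rational (ykk N e) \<and> complex_rational (ykm N e) \<and>
          complex_rational (ymk N e) \<and> complex_rational (ymm N e) \<and>
          (ulim N e = \<infinity> \<or> (\<exists>u\<in>\<rat>. ulim N e = ereal u))) \<and>
     (\<forall>k. pd N k \<in> \<rat> \<and> qd N k \<in> \<rat> \<and> vmin N k \<in> \<rat> \<and> vmax N k \<in> \<rat>) \<and>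
     (\<forall>g. pmin N g \<in> \<rat> \<and> pmax N g \<in> \<rat> \<and> qmin N g \<in> \<rat> \<and> qmax N g \<in> \<rat> \<and>
          (\<exists>p. (\<forall>i. coeff p i \<in> \<rat>) \<and> cost N g = poly p))"

text \<open>
  The usual model of a transmission line: series resistance \<open>r\<close> and reactance \<open>x\<close>, and a line
  charging susceptance \<open>b\<close>, half of which is placed at each end. The series conductance is
  \<open>r / (r\<^sup>2 + x\<^sup>2) \<ge> 0\<close>.
\<close>

definition standard_line :: "('b::finite, 'e::finite, 'g::finite) acopf \<Rightarrow> 'e \<Rightarrow> bool" where
  "standard_line N e \<longleftrightarrow>
     (\<exists>r x b. 0 \<le> r \<and> 0 < x \<and> 0 \<le> b \<and>
        (let y = 1 / Complex r x in
           ykk N e = y + Complex 0 (b / 2) \<and> ymm N e = y + Complex 0 (b / 2) \<and>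
           ykm N e = - y \<and> ymk N e = - y))"

text \<open>
  Right-hand sides of the power-flow equations at the two ends of a branch, as functions of the
  squared voltage magnitude at that end and of \<open>w = V\<^sub>k V\<^sub>m\<^sup>*\<close>. Note that \<open>G - jB\<close> is the
  conjugate of the admittance entry, and that \<open>V\<^sub>m V\<^sub>k\<^sup>*\<close> is the conjugate of \<open>w\<close>.
\<close>

definition flow_km :: "('b::finite, 'e::finite, 'g::finite) acopf \<Rightarrow> 'e \<Rightarrow> real \<Rightarrow> complex \<Rightarrow> complex" where
  "flow_km N e a w = cnj (ykk N e) * of_real a + cnj (ykm N e) * w"

definition flow_mk :: "('b::finite, 'e::finite, 'g::finite) acopf \<Rightarrow> 'e \<Rightarrow> real \<Rightarrow> complex \<Rightarrow> complex" where
  "flow_mk N e a w = cnj (ymm N e) * of_real a + cnj (ymk N e) * cnj w"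

record ('e, 'g) powers =
  pg :: "'g \<Rightarrow> real"
  qg :: "'g \<Rightarrow> real"
  pkm :: "'e \<Rightarrow> real"
  qkm :: "'e \<Rightarrow> real"
  pmk :: "'e \<Rightarrow> real"
  qmk :: "'e \<Rightarrow> real"

definition p_mismatch ::
    "('b::finite, 'e::finite, 'g::finite) acopf \<Rightarrow> ('e, 'g, 'z) powers_scheme \<Rightarrow> 'b \<Rightarrow> real" where
  "p_mismatch N x k =
     (\<Sum>e | src N e = k. pkm x e) + (\<Sum>e | dst N e = k. pmk x e)
       - ((\<Sum>g | gbus N g = k. pg x g) - pd N k)"

definition q_mismatch ::
    "('b::finite, 'e::finite, 'g::finite) acopf \<Rightarrow> ('e, 'g, 'z) powers_scheme \<Rightarrow> 'b \<Rightarrow> real" where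
  "q_mismatch N x k =
     (\<Sum>e | src N e = k. qkm x e) + (\<Sum>e | dst N e = k. qmk x e)
       - ((\<Sum>g | gbus N g = k. qg x g) - qd N k)"

definition power_constraints ::
    "('b::finite, 'e::finite, 'g::finite) acopf \<Rightarrow> ('e, 'g, 'z) powers_scheme \<Rightarrow> bool" where
  "power_constraints N x \<longleftrightarrow>
     (\<forall>k. p_mismatch N x k = 0 \<and> q_mismatch N x k = 0) \<and>
     (\<forall>g. pmin N g \<le> pg x g \<and> pg x g \<le> pmax N g \<and> qmin N g \<le> qg x g \<and> qg x g \<le> qmax N g) \<and>
     (\<forall>e. ereal (max ((pkm x e)\<^sup>2 + (qkm x e)\<^sup>2) ((pmk x e)\<^sup>2 + (qmk x e)\<^sup>2)) \<le> ulim N e)"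

definition total_cost ::
    "('b::finite, 'e::finite, 'g::finite) acopf \<Rightarrow> ('e, 'g, 'z) powers_scheme \<Rightarrow> real" where
  "total_cost N x = (\<Sum>g\<in>UNIV. cost N g (pg x g))"

definition powers_rational :: "('e, 'g, 'z) powers_scheme \<Rightarrow> bool" where
  "powers_rational x \<longleftrightarrow>
     (\<forall>g. pg x g \<in> \<rat> \<and> qg x g \<in> \<rat>) \<and>
     (\<forall>e. pkm x e \<in> \<rat> \<and> qkm x e \<in> \<rat> \<and> pmk x e \<in> \<rat> \<and> qmk x e \<in> \<rat>)"


subsection \<open>ACOPF\<close>

record ('b, 'e, 'g) ac_point = "('e, 'g) powers" +
  vmag :: "'b \<Rightarrow> real"
  vang :: "'b \<Rightarrow> real"

definition volt :: "('b, 'e, 'g) ac_point \<Rightarrow> 'b \<Rightarrow> complex" where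
  "volt x k = of_real (vmag x k) * cis (vang x k)"

definition ac_feasible ::
    "('b::finite, 'e::finite, 'g::finite) acopf \<Rightarrow> ('b, 'e, 'g) ac_point \<Rightarrow> bool" where
  "ac_feasible N x \<longleftrightarrow>
     power_constraints N x \<and>
     (\<forall>k. 0 \<le> vmag x k \<and> (vmin N k)\<^sup>2 \<le> (vmag x k)\<^sup>2 \<and> (vmag x k)\<^sup>2 \<le> (vmax N k)\<^sup>2) \<and>
     (\<forall>e. let k = src N e; m = dst N e; w = volt x k * cnj (volt x m) in
        Complex (pkm x e) (qkm x e) = flow_km N e ((vmag x k)\<^sup>2) w \<and>
        Complex (pmk x e) (qmk x e) = flow_mk N e ((vmag x m)\<^sup>2) w)"

text \<open>
  Only angle differences (modulo \<open>2\<pi>\<close>) matter: feasible points are counted up to a common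
  rotation of all voltages.
\<close>

definition same_up_to_rotation :: "(('b, 'e, 'g) ac_point \<times> ('b, 'e, 'g) ac_point) set" where
  "same_up_to_rotation =
     {(x, y). x\<lparr>vang := vang y\<rparr> = y \<and> (\<exists>\<phi>. \<forall>k. cis (vang y k) = cis (vang x k + \<phi>))}"

definition ac_rational :: "('b, 'e, 'g) ac_point \<Rightarrow> bool" where
  "ac_rational x \<longleftrightarrow> powers_rational x \<and> (\<forall>k. vmag x k \<in> \<rat> \<and> vang x k \<in> \<rat>)"


subsection \<open>The Jabr relaxation\<close>

record ('b, 'e, 'g) jabr_point = "('e, 'g) powers" +
  v2 :: "'b \<Rightarrow> real"
  cc :: "'e \<Rightarrow> real"
  ss :: "'e \<Rightarrow> real"

definition jabr_feasible ::
    "('b::finite, 'e::finite, 'g::finite) acopf \<Rightarrow> ('b, 'e, 'g) jabr_point \<Rightarrow> bool" where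
  "jabr_feasible N x \<longleftrightarrow>
     power_constraints N x \<and>
     (\<forall>k. (vmin N k)\<^sup>2 \<le> v2 x k \<and> v2 x k \<le> (vmax N k)\<^sup>2) \<and>
     (\<forall>e. let k = src N e; m = dst N e; w = Complex (cc x e) (ss x e) in
        Complex (pkm x e) (qkm x e) = flow_km N e (v2 x k) w \<and>
        Complex (pmk x e) (qmk x e) = flow_mk N e (v2 x m) w \<and>
        (cc x e)\<^sup>2 + (ss x e)\<^sup>2 \<le> v2 x k * v2 x m)"

definition jabr_minimizer ::
    "('b::finite, 'e::finite, 'g::finite) acopf \<Rightarrow> ('b, 'e, 'g) jabr_point \<Rightarrow> bool" where
  "jabr_minimizer N x \<longleftrightarrow>
     jabr_feasible N x \<and> (\<forall>y. jabr_feasible N y \<longrightarrow> total_cost N x \<le> total_cost N y)"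

definition jabr_rational :: "('b, 'e, 'g) jabr_point \<Rightarrow> bool" where
  "jabr_rational x \<longleftrightarrow>
     powers_rational x \<and> (\<forall>k. v2 x k \<in> \<rat>) \<and> (\<forall>e. cc x e \<in> \<rat> \<and> ss x e \<in> \<rat>)"


subsection \<open>The Lagrangian dual of the Jabr relaxation\<close>

text \<open>
  Every constraint is dualized: each real equation has a free multiplier, each one-sided scalar
  inequality a nonnegative one (lower and upper limits separately, and one for each end of a
  branch limit). The function \<open>c\<^sup>2 + s\<^sup>2 - v\<^sub>k v\<^sub>m\<close> is not convex, so the rotated-cone
  inequality is dualized as the conic constraint \<open>(v\<^sub>k, v\<^sub>m, c, s) \<in> rotated_cone\<close>, with a
  multiplier in the dual cone; both forms agree because \<open>v\<^sub>k \<ge> (V\<^sub>k\<^sup>m\<^sup>i\<^sup>n)\<^sup>2 \<ge> 0\<close>.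
\<close>

definition rotated_cone :: "(real \<times> real \<times> real \<times> real) set" where
  "rotated_cone = {(a, b, c, s). 0 \<le> a \<and> 0 \<le> b \<and> c\<^sup>2 + s\<^sup>2 \<le> a * b}"

definition dual_cone :: "'a::real_inner set \<Rightarrow> 'a set" where
  "dual_cone K = {y. \<forall>x\<in>K. 0 \<le> x \<bullet> y}"

record ('b, 'e, 'g) multipliers =
  m_pbal :: "'b \<Rightarrow> real"
  m_qbal :: "'b \<Rightarrow> real"
  m_pkm :: "'e \<Rightarrow> real"
  m_qkm :: "'e \<Rightarrow> real"
  m_pmk :: "'e \<Rightarrow> real"
  m_qmk :: "'e \<Rightarrow> real"
  m_pmin :: "'g \<Rightarrow> real"
  m_pmax :: "'g \<Rightarrow> real"
  m_qmin :: "'g \<Rightarrow> real"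
  m_qmax :: "'g \<Rightarrow> real"
  m_vmin :: "'b \<Rightarrow> real"
  m_vmax :: "'b \<Rightarrow> real"
  m_ukm :: "'e \<Rightarrow> real"
  m_umk :: "'e \<Rightarrow> real"
  m_cone :: "'e \<Rightarrow> real \<times> real \<times> real \<times> real"

text \<open>An absent branch limit contributes nothing, so its multipliers are fixed at \<open>0\<close>.\<close>

definition dual_feasible ::
    "('b::finite, 'e::finite, 'g::finite) acopf \<Rightarrow> ('b, 'e, 'g) multipliers \<Rightarrow> bool" where
  "dual_feasible N l \<longleftrightarrow>
     (\<forall>g. 0 \<le> m_pmin l g \<and> 0 \<le> m_pmax l g \<and> 0 \<le> m_qmin l g \<and> 0 \<le> m_qmax l g) \<and>
     (\<forall>k. 0 \<le> m_vmin l k \<and> 0 \<le> m_vmax l k) \<and>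
     (\<forall>e. 0 \<le> m_ukm l e \<and> 0 \<le> m_umk l e \<and>
          (ulim N e = \<infinity> \<longrightarrow> m_ukm l e = 0 \<and> m_umk l e = 0) \<and>
          m_cone l e \<in> dual_cone rotated_cone)"

definition lagrangian ::
    "('b::finite, 'e::finite, 'g::finite) acopf \<Rightarrow> ('b, 'e, 'g) multipliers
      \<Rightarrow> ('b, 'e, 'g) jabr_point \<Rightarrow> real" where
  "lagrangian N l x =
     total_cost N x
     + (\<Sum>k\<in>UNIV. m_pbal l k * p_mismatch N x k + m_qbal l k * q_mismatch N x k)
     + (\<Sum>g\<in>UNIV. m_pmin l g * (pmin N g - pg x g) + m_pmax l g * (pg x g - pmax N g)
                 + m_qmin l g * (qmin N g - qg x g) + m_qmax l g * (qg x g - qmax N g))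
     + (\<Sum>k\<in>UNIV. m_vmin l k * ((vmin N k)\<^sup>2 - v2 x k) + m_vmax l k * (v2 x k - (vmax N k)\<^sup>2))
     + (\<Sum>e\<in>UNIV.
          let k = src N e; m = dst N e; w = Complex (cc x e) (ss x e);
              skm = flow_km N e (v2 x k) w; smk = flow_mk N e (v2 x m) w;
              u = real_of_ereal (ulim N e) in
            m_pkm l e * (pkm x e - Re skm) + m_qkm l e * (qkm x e - Im skm)
          + m_pmk l e * (pmk x e - Re smk) + m_qmk l e * (qmk x e - Im smk)
          + m_ukm l e * ((pkm x e)\<^sup>2 + (qkm x e)\<^sup>2 - u)
          + m_umk l e * ((pmk x e)\<^sup>2 + (qmk x e)\<^sup>2 - u)
          - m_cone l e \<bullet> (v2 x k, v2 x m, cc x e, ss x e))"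

definition dual_function ::
    "('b::finite, 'e::finite, 'g::finite) acopf \<Rightarrow> ('b, 'e, 'g) multipliers \<Rightarrow> ereal" where
  "dual_function N l = (INF x. ereal (lagrangian N l x))"

definition dual_maximizer ::
    "('b::finite, 'e::finite, 'g::finite) acopf \<Rightarrow> ('b, 'e, 'g) multipliers \<Rightarrow> bool" where
  "dual_maximizer N l \<longleftrightarrow>
     dual_feasible N l \<and> (\<forall>l'. dual_feasible N l' \<longrightarrow> dual_function N l' \<le> dual_function N l)"

definition multipliers_rational :: "('b, 'e, 'g) multipliers \<Rightarrow> bool" where
  "multipliers_rational l \<longleftrightarrow>
     (\<forall>k. m_pbal l k \<in> \<rat> \<and> m_qbal l k \<in> \<rat> \<and> m_vmin l k \<in> \<rat> \<and> m_vmax l k \<in> \<rat>) \<and>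
     (\<forall>g. m_pmin l g \<in> \<rat> \<and> m_pmax l g \<in> \<rat> \<and> m_qmin l g \<in> \<rat> \<and> m_qmax l g \<in> \<rat>) \<and>
     (\<forall>e. m_pkm l e \<in> \<rat> \<and> m_qkm l e \<in> \<rat> \<and> m_pmk l e \<in> \<rat> \<and> m_qmk l e \<in> \<rat> \<and>
          m_ukm l e \<in> \<rat> \<and> m_umk l e \<in> \<rat> \<and>
          m_cone l e \<in> \<rat> \<times> \<rat> \<times> \<rat> \<times> \<rat>)"

end

theory Submission
  imports Defs
begin

text \<open>
  The instance is a line with series impedance \<open>(1 + j) / 2\<close> and charging susceptance \<open>2\<close>, so
  that the charging cancels the series susceptance and the diagonal admittances are \<open>1\<close>. The only
  generator is at bus 1, the only load is one unit of active power at bus 2. Let \<open>a\<close> and \<open>b\<close> be the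
  squared voltage magnitudes at buses 1 and 2. The load fixes \<open>c = s = (b + 1) / 2\<close>, and the generator
  produces \<open>P = a\<close>, \<open>Q = - (b + 1)\<close>. The plane with coordinates \<open>(a, b)\<close> therefore carries the whole
  problem, and the cone inequality becomes \<open>(b + 1)\<^sup>2 \<le> 2 a b\<close>, that is
  \<open>a \<ge> (b + 2 + 1 / b) / 2\<close>, the region above a convex curve.

  The limits on \<open>|V\<^sub>1|\<close> and on \<open>Q\<close> give \<open>a \<ge> 9/4\<close> and \<open>1/2 \<le> b \<le> 2\<close>. The lower edge of this strip
  is exactly the chord of the curve between \<open>b = 1/2\<close> and \<open>b = 2\<close>, so the strip lies above the curve
  and touches it in the two corners only (lemma \<open>feasible_on_cone_boundary\<close>). AC feasible points are
  the ones on the curve, hence there are two of them, with \<open>|V\<^sub>2|\<^sup>2 \<in> {1/2, 2}\<close>.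

  The optimum of the relaxation lies in the interior of the cone, where it is decided by the
  quadratic branch limit \<open>P\<^sup>2 + Q\<^sup>2 \<le> 81/4\<close>. The cost \<open>- P\<close> (a convex function of the output)
  pushes \<open>P\<close> up to this circle; since \<open>|Q| \<ge> 3/2\<close>, the best point is \<open>P = sqrt (81/4 - 9/4) = 3 sqrt 2\<close>,
  \<open>Q = - 3/2\<close>, and it is unique (lemma \<open>jabr_sol_optimal\<close>).

  At this optimum only two inequalities are active: the branch limit and the upper limit on \<open>Q\<close>.
  All the others, the cone included, are strict, so complementary slackness makes their multipliers
  vanish; stationarity of the Lagrangian in the ten variables then determines the remaining
  multipliers, among them \<open>sqrt 2 / 12\<close> for the branch limit (lemmas \<open>dual_sol_unique\<close> and
  \<open>stationary_multipliers\<close>).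
\<close>

section \<open>Irrationality of the square root of 2, and stationarity\<close>

lemma rational_square_neq_2:
  fixes x :: real
  assumes "x \<in> \<rat>"
  shows "x\<^sup>2 \<noteq> 2"
proof
  assume sq: "x\<^sup>2 = 2"
  obtain m n :: nat where n: "n \<noteq> 0" and x: "\<bar>x\<bar> = m / n" and cop: "coprime m n"
    using Rats_abs_nat_div_natE [OF assms] by metis
  have "(real m)\<^sup>2 = 2 * (real n)\<^sup>2"
    using sq n x by (metis abs_eq_0 eq_divide_eq of_nat_eq_0_iff power2_abs power_mult_distrib)
  hence eq: "m\<^sup>2 = 2 * n\<^sup>2"
    by (metis (mono_tags) of_nat_eq_iff of_nat_mult of_nat_numeral of_nat_power)
  hence m: "even m" by (metis dvd_triv_left even_power)
  then obtain k where "m = 2 * k" ..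
  with eq have "n\<^sup>2 = 2 * k\<^sup>2" by (simp add: power2_eq_square)
  hence "even n" by (metis dvd_triv_left even_power)
  with m cop show False by (metis coprime_common_divisor_nat nat_dvd_1_iff_1 odd_one)
qed

lemma sqrt_2_irrational: "sqrt 2 \<notin> \<rat>"
  using rational_square_neq_2 [of "sqrt 2"] by auto

text \<open>The first-order condition for a minimum of a quadratic polynomial at \<open>0\<close>.\<close>

lemma stationary_at_0:
  fixes A B :: real
  assumes "\<And>t. 0 \<le> A * t + B * t\<^sup>2"
  shows "A = 0"
proof (rule ccontr)
  assume A: "A \<noteq> 0"
  define d where "d = \<bar>B\<bar> + 1"
  have d: "0 < d" "B < d" by (auto simp: d_def)
  have "A * (- A / d) + B * (- A / d)\<^sup>2 = A\<^sup>2 * (B - d) / d\<^sup>2"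
    using d by (simp add: power2_eq_square field_simps)
  moreover have "A\<^sup>2 * (B - d) / d\<^sup>2 < 0"
    using A d by (intro divide_neg_pos mult_pos_neg) auto
  ultimately show False using assms [of "- A / d"] by simp
qed


section \<open>The instance\<close>

text \<open>
  The voltage limits at bus 2 and the upper ones at bus 1, the limits on \<open>P\<close> and the branch limit
  at the receiving end are chosen wide enough to be strict at the optimum of the relaxation; with an
  equality \<open>V\<^sup>m\<^sup>i\<^sup>n = V\<^sup>m\<^sup>a\<^sup>x\<close>, say, the two multipliers could be raised together and the dual maximizer
  would not be unique.
\<close>

definition two_bus :: "(2, 1, 1) acopf" where
  "two_bus =
     \<lparr>src = (\<lambda>_. 1), dst = (\<lambda>_. 2),
      ykk = (\<lambda>_. 1), ykm = (\<lambda>_. Complex (-1) 1), ymk = (\<lambda>_. Complex (-1) 1), ymm = (\<lambda>_. 1),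
      ulim = (\<lambda>_. ereal (81/4)),
      pd = (\<lambda>k. if k = 1 then 0 else 1), qd = (\<lambda>_. 0),
      vmin = (\<lambda>k. if k = 1 then 3/2 else 1/2), vmax = (\<lambda>_. 3),
      gbus = (\<lambda>_. 1),
      pmin = (\<lambda>_. 0), pmax = (\<lambda>_. 10), qmin = (\<lambda>_. - 3), qmax = (\<lambda>_. - 3/2),
      cost = (\<lambda>_ p. - p)\<rparr>"

lemma two_bus_instance: "acopf_instance two_bus"
  by (simp add: acopf_instance_def two_bus_def convex_on_def algebra_simps)

lemma two_bus_standard_line: "standard_line two_bus e"
proof -
  have "1 / Complex (1/2) (1/2) = Complex 1 (-1)"
    by (simp add: complex_eq_iff Re_divide Im_divide power2_eq_square)
  thus ?thesis
    unfolding standard_line_def Let_def two_bus_def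
    by (intro exI [of _ "1/2"] exI [of _ 2]) (simp add: complex_eq_iff)
qed

lemma two_bus_rational_data: "rational_data two_bus"
proof -
  have "\<exists>p. (\<forall>i. coeff p i \<in> \<rat>) \<and> (\<lambda>x::real. - x) = poly p"
    by (rule exI [of _ "[:0, -1:]"]) (auto simp: coeff_pCons split: nat.splits)
  moreover have "\<exists>u\<in>\<rat>. ereal (81/4) = ereal u" by (rule bexI [of _ "81/4"]) auto
  ultimately show ?thesis
    unfolding rational_data_def two_bus_def complex_rational_def
    by (simp del: ereal.inject)
qed

lemma two_bus_mismatch:
  "p_mismatch two_bus x 1 = pkm x 1 - pg x 1" "p_mismatch two_bus x 2 = pmk x 1 + 1"
  "q_mismatch two_bus x 1 = qkm x 1 - qg x 1" "q_mismatch two_bus x 2 = qmk x 1"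
  by (simp_all add: p_mismatch_def q_mismatch_def two_bus_def sum_1)

lemma two_bus_flow:
  "flow_km two_bus e a (Complex c s) = Complex (a - c + s) (- c - s)"
  "flow_mk two_bus e b (Complex c s) = Complex (b - c - s) (s - c)"
  by (simp_all add: flow_km_def flow_mk_def two_bus_def complex_eq_iff)

lemma two_bus_cost: "total_cost two_bus x = - pg x 1"
  by (simp add: total_cost_def two_bus_def sum_1)

lemma two_bus_power_constraints:
  "power_constraints two_bus x \<longleftrightarrow>
     pkm x 1 = pg x 1 \<and> qkm x 1 = qg x 1 \<and> pmk x 1 = - 1 \<and> qmk x 1 = 0 \<and>
     0 \<le> pg x 1 \<and> pg x 1 \<le> 10 \<and> - 3 \<le> qg x 1 \<and> qg x 1 \<le> - 3/2 \<and>
     (pkm x 1)\<^sup>2 + (qkm x 1)\<^sup>2 \<le> 81/4 \<and> (pmk x 1)\<^sup>2 + (qmk x 1)\<^sup>2 \<le> 81/4"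
  unfolding power_constraints_def forall_2 forall_1 two_bus_mismatch
  by (auto simp: two_bus_def)

text \<open>
  The two complex flow equations are an invertible linear system: the power drawn at bus 2 fixes
  \<open>c\<close> and \<open>s\<close> in terms of \<open>b\<close>, and the equation at bus 1 then gives the generated power. This is
  common to the AC problem, with \<open>c + j s = V\<^sub>1 V\<^sub>2\<^sup>*\<close>, and to the relaxation.
\<close>

lemma power_flow_solution:
  fixes pk qk a b c s :: real
  shows "Complex pk qk = Complex (a - c + s) (- c - s) \<and> Complex (-1) 0 = Complex (b - c - s) (s - c)
     \<longleftrightarrow> pk = a \<and> qk = - (b + 1) \<and> c = (b + 1) / 2 \<and> s = (b + 1) / 2"
  by (auto simp: field_simps)



section \<open>AC feasible points\<close>

text \<open>
  Putting \<open>a \<ge> 9/4\<close> into the equation of the curve gives \<open>(2 b - 1) (b - 2) \<ge> 0\<close>, whose roots are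
  the two limits on \<open>b\<close>.
\<close>

lemma feasible_on_cone_boundary:
  fixes a b :: real
  assumes "(b + 1)\<^sup>2 = 2 * a * b" "9/4 \<le> a" "1/2 \<le> b" "b \<le> 2"
  shows "a = 9/4 \<and> (b = 1/2 \<or> b = 2)"
proof -
  have "9/2 * b \<le> 2 * a * b" using assms by simp
  with assms(1) have "0 \<le> (2 * b - 1) * (b - 2)"
    by (simp add: power2_eq_square algebra_simps)
  hence b: "b = 1/2 \<or> b = 2"
    using assms by (auto simp: zero_le_mult_iff)
  hence "a = (b + 1)\<^sup>2 / (2 * b)" using assms(1) by auto
  with b show ?thesis by (elim disjE) (hypsubst, simp add: power2_eq_square)+
qed

text \<open>
  Since \<open>c = s > 0\<close>, the angle difference is \<open>\<pi> / 4\<close> at both solutions; the angle at bus 2 is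
  normalized to \<open>0\<close>.
\<close>

definition ac_sol :: "real \<Rightarrow> (2, 1, 1) ac_point" where
  "ac_sol b =
     \<lparr>pg = (\<lambda>_. 9/4), qg = (\<lambda>_. - (b + 1)),
      pkm = (\<lambda>_. 9/4), qkm = (\<lambda>_. - (b + 1)), pmk = (\<lambda>_. - 1), qmk = (\<lambda>_. 0),
      vmag = (\<lambda>k. if k = 1 then 3/2 else sqrt b), vang = (\<lambda>k. if k = 1 then pi/4 else 0)\<rparr>"

lemma two_bus_ac_feasible:
  "ac_feasible two_bus x \<longleftrightarrow>
     power_constraints two_bus x \<and>
     3/2 \<le> vmag x 1 \<and> vmag x 1 \<le> 3 \<and> 1/2 \<le> vmag x 2 \<and> vmag x 2 \<le> 3 \<and>
     pkm x 1 = (vmag x 1)\<^sup>2 \<and> qkm x 1 = - ((vmag x 2)\<^sup>2 + 1) \<and>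
     volt x 1 * cnj (volt x 2) = Complex (((vmag x 2)\<^sup>2 + 1) / 2) (((vmag x 2)\<^sup>2 + 1) / 2)"
proof -
  obtain c s where w: "volt x 1 * cnj (volt x 2) = Complex c s" by (metis complex.exhaust)
  have lim: "0 \<le> v \<and> l\<^sup>2 \<le> v\<^sup>2 \<and> v\<^sup>2 \<le> u\<^sup>2 \<longleftrightarrow> l \<le> v \<and> v \<le> u"
    if "0 < l" "0 < u" for l v u :: real
    using that by (smt (verit) power2_le_imp_le power_mono)
  have net: "src two_bus e = 1" "dst two_bus e = 2" "vmin two_bus 1 = 3/2" "vmin two_bus 2 = 1/2"
    "vmax two_bus k = 3" for e k
    by (simp_all add: two_bus_def)
  have pm: "pmk x 1 = - 1" "qmk x 1 = 0" if "power_constraints two_bus x"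
    using that by (auto simp: two_bus_power_constraints)
  show ?thesis
    unfolding ac_feasible_def forall_2 forall_1 Let_def net w two_bus_flow
    using lim [of "3/2" 3 "vmag x 1"] lim [of "1/2" 3 "vmag x 2"] pm
      power_flow_solution [of "pkm x 1" "qkm x 1" "(vmag x 1)\<^sup>2" c s "(vmag x 2)\<^sup>2"]
    by auto
qed

lemma volt_mult_cnj:
  "volt x k * cnj (volt x m) = of_real (vmag x k * vmag x m) * cis (vang x k - vang x m)"
  by (simp add: volt_def cis_cnj cis_mult)

lemma cis_pi_4: "cis (pi/4) = of_real (sqrt 2 / 2) * Complex 1 1"
  by (simp add: complex_eq_iff cos_45 sin_45)

text \<open>
  The identity \<open>|V\<^sub>1 V\<^sub>2\<^sup>*|\<^sup>2 = |V\<^sub>1|\<^sup>2 |V\<^sub>2|\<^sup>2\<close> turns the cone inequality into an equation for AC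
  feasible points.
\<close>

lemma ac_feasible_vmag:
  assumes "ac_feasible two_bus x"
  shows "(vmag x 1)\<^sup>2 = 9/4" "(vmag x 2)\<^sup>2 = 1/2 \<or> (vmag x 2)\<^sup>2 = 2"
proof -
  note feas = assms [unfolded two_bus_ac_feasible two_bus_power_constraints]
  define a b where "a = (vmag x 1)\<^sup>2" and "b = (vmag x 2)\<^sup>2"
  have "cmod (volt x 1 * cnj (volt x 2)) = \<bar>vmag x 1 * vmag x 2\<bar>"
    by (simp add: volt_mult_cnj norm_mult abs_mult)
  hence "(cmod (volt x 1 * cnj (volt x 2)))\<^sup>2 = a * b"
    by (simp add: a_def b_def power_mult_distrib)
  moreover have "volt x 1 * cnj (volt x 2) = Complex ((b + 1) / 2) ((b + 1) / 2)"
    using feas by (simp add: b_def)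
  ultimately have "((b + 1) / 2)\<^sup>2 + ((b + 1) / 2)\<^sup>2 = a * b"
    by (simp add: cmod_power2)
  hence cone: "(b + 1)\<^sup>2 = 2 * a * b" by (simp add: power2_eq_square field_simps)
  have "(3/2)\<^sup>2 \<le> a" unfolding a_def using feas by (intro power_mono) auto
  hence "9/4 \<le> a" by (simp add: power2_eq_square)
  moreover have "1/2 \<le> b" "b \<le> 2" using feas by (auto simp: b_def)
  ultimately show "(vmag x 1)\<^sup>2 = 9/4" "(vmag x 2)\<^sup>2 = 1/2 \<or> (vmag x 2)\<^sup>2 = 2"
    using feasible_on_cone_boundary [OF cone] by (auto simp: a_def b_def)
qed

lemma ac_sol_feasible:
  assumes "b = 1/2 \<or> b = 2"
  shows "ac_feasible two_bus (ac_sol b)"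
proof -
  have b: "0 \<le> b" using assms by auto
  \<comment> \<open>the modulus of \<open>V\<^sub>1 V\<^sub>2\<^sup>*\<close>, which holds for these two values of \<open>b\<close> only\<close>
  have "3/2 * sqrt b * (sqrt 2 / 2) = (b + 1) / 2"
  proof -
    have "sqrt b * sqrt 2 = sqrt (b * 2)" by (simp add: real_sqrt_mult)
    also have "\<dots> = (b + 1) * 2 / 3" using assms
      by (elim disjE) (hypsubst, simp)+
    finally show ?thesis by simp
  qed
  moreover have "volt (ac_sol b) 1 * cnj (volt (ac_sol b) 2)
      = of_real (3/2 * sqrt b * (sqrt 2 / 2)) * Complex 1 1"
    by (simp add: volt_mult_cnj ac_sol_def cis_pi_4)
  ultimately have "volt (ac_sol b) 1 * cnj (volt (ac_sol b) 2) = Complex ((b + 1) / 2) ((b + 1) / 2)"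
    by (simp only:) (simp add: complex_eq_iff)
  moreover have "1/2 \<le> sqrt b"
    by (rule real_le_rsqrt) (use assms in \<open>auto simp: power2_eq_square\<close>)
  moreover have "sqrt b \<le> 3"
    by (rule real_le_lsqrt) (use assms in auto)
  moreover have "power_constraints two_bus (ac_sol b)"
    using assms
    by (elim disjE) (hypsubst, simp add: two_bus_power_constraints ac_sol_def power2_eq_square)+
  ultimately show ?thesis
    using b by (simp add: two_bus_ac_feasible ac_sol_def power2_eq_square)
qed

lemma equiv_same_up_to_rotation:
  "equiv UNIV (same_up_to_rotation :: (('b, 'e, 'g) ac_point \<times> ('b, 'e, 'g) ac_point) set)"
proof (rule equivI)
  show "same_up_to_rotation \<subseteq> UNIV \<times> UNIV" by simp
  show "refl (same_up_to_rotation :: (('b, 'e, 'g) ac_point \<times> _) set)"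
    by (auto simp: refl_on_def same_up_to_rotation_def intro: exI [of _ 0])
  show "sym (same_up_to_rotation :: (('b, 'e, 'g) ac_point \<times> _) set)"
  proof (rule symI)
    fix x y :: "('b, 'e, 'g) ac_point"
    assume "(x, y) \<in> same_up_to_rotation"
    then obtain \<phi> where y: "x\<lparr>vang := vang y\<rparr> = y"
      and \<phi>: "\<And>k. cis (vang y k) = cis (vang x k + \<phi>)"
      by (auto simp: same_up_to_rotation_def)
    have "cis (vang x k) = cis (vang y k + - \<phi>)" for k
    proof -
      have "cis (vang y k + - \<phi>) = cis (vang y k) * cis (- \<phi>)" by (simp only: cis_mult)
      thus ?thesis by (simp add: \<phi> cis_mult)
    qed
    moreover have "y\<lparr>vang := vang x\<rparr> = x" by (subst y [symmetric]) simp
    ultimately show "(y, x) \<in> same_up_to_rotation"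
      unfolding same_up_to_rotation_def by blast
  qed
  show "trans (same_up_to_rotation :: (('b, 'e, 'g) ac_point \<times> _) set)"
  proof (rule transI)
    fix x y z :: "('b, 'e, 'g) ac_point"
    assume "(x, y) \<in> same_up_to_rotation" "(y, z) \<in> same_up_to_rotation"
    then obtain \<phi> \<psi> where y: "x\<lparr>vang := vang y\<rparr> = y" and z: "y\<lparr>vang := vang z\<rparr> = z"
      and \<phi>: "\<And>k. cis (vang y k) = cis (vang x k + \<phi>)"
      and \<psi>: "\<And>k. cis (vang z k) = cis (vang y k + \<psi>)"
      by (auto simp: same_up_to_rotation_def)
    have "cis (vang z k) = cis (vang x k + (\<phi> + \<psi>))" for k
      using \<phi> [of k] \<psi> [of k] by (simp add: cis_mult [symmetric] mult.assoc)
    moreover have "x\<lparr>vang := vang z\<rparr> = z"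
      using arg_cong [OF y, of "\<lambda>u. u\<lparr>vang := vang z\<rparr>"] z by simp
    ultimately show "(x, z) \<in> same_up_to_rotation"
      unfolding same_up_to_rotation_def by blast
  qed
qed

text \<open>
  The squared magnitudes determine every other coordinate, and the magnitudes are nonzero, so the
  value of \<open>V\<^sub>1 V\<^sub>2\<^sup>*\<close> fixes the angle difference modulo \<open>2 \<pi>\<close>. Only the angle at bus 2 is free, and
  rotating by it maps the normalized solution to the given one.
\<close>

lemma ac_feasible_is_ac_sol:
  assumes "ac_feasible two_bus x"
  shows "(ac_sol ((vmag x 2)\<^sup>2), x) \<in> same_up_to_rotation"
proof -
  note feas = assms [unfolded two_bus_ac_feasible two_bus_power_constraints]
  define b where "b = (vmag x 2)\<^sup>2"
  have b: "b = 1/2 \<or> b = 2" and v1: "(vmag x 1)\<^sup>2 = 9/4"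
    using ac_feasible_vmag [OF assms] by (auto simp: b_def)
  have "vmag x 1 = 3/2"
    using feas power2_eq_imp_eq [of "vmag x 1" "3/2"] v1 by (simp add: power2_eq_square)
  moreover have "vmag x 2 = sqrt b" using feas by (simp add: b_def)
  ultimately have vmag: "vmag x = vmag (ac_sol b)"
    by (simp add: fun_eq_iff forall_2 ac_sol_def)
  have "of_real (vmag x 1 * vmag x 2) * cis (vang x 1 - vang x 2)
      = of_real (vmag x 1 * vmag x 2) * cis (pi/4)"
  proof -
    have "volt x 1 * cnj (volt x 2) = volt (ac_sol b) 1 * cnj (volt (ac_sol b) 2)"
      using feas ac_sol_feasible [OF b, unfolded two_bus_ac_feasible] b_def vmag by metis
    thus ?thesis unfolding volt_mult_cnj vmag by (simp add: ac_sol_def)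
  qed
  moreover have "vmag x 1 * vmag x 2 \<noteq> 0" using feas by auto
  ultimately have "cis (vang x 1 - vang x 2) = cis (pi/4)" by simp
  hence "cis (vang x 1) = cis (pi/4 + vang x 2)"
    by (metis cis_mult diff_add_cancel)
  hence "\<forall>k. cis (vang x k) = cis (vang (ac_sol b) k + vang x 2)"
    by (simp add: forall_2 ac_sol_def)
  moreover have "(ac_sol b)\<lparr>vang := vang x\<rparr> = x"
  proof (rule ac_point.equality)
    show "vmag ((ac_sol b)\<lparr>vang := vang x\<rparr>) = vmag x" using vmag by simp
  qed (use feas v1 in \<open>auto simp: ac_sol_def fun_eq_iff forall_1 b_def\<close>)
  ultimately show ?thesis
    unfolding same_up_to_rotation_def b_def [symmetric] by blast
qed

lemma card_ac_feasible: "card ({x. ac_feasible two_bus x} // same_up_to_rotation) = 2"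
proof -
  let ?R = "same_up_to_rotation :: ((2, 1, 1) ac_point \<times> _) set"
  have cls: "?R `` {x} = ?R `` {ac_sol ((vmag x 2)\<^sup>2)}" if "ac_feasible two_bus x" for x
    using ac_feasible_is_ac_sol [OF that] equiv_class_eq [OF equiv_same_up_to_rotation] by metis
  have "{x. ac_feasible two_bus x} // ?R = {?R `` {ac_sol (1/2)}, ?R `` {ac_sol 2}}"
  proof
    show "{x. ac_feasible two_bus x} // ?R \<subseteq> {?R `` {ac_sol (1/2)}, ?R `` {ac_sol 2}}"
      using cls ac_feasible_vmag(2) by (fastforce elim!: quotientE)
    show "{?R `` {ac_sol (1/2)}, ?R `` {ac_sol 2}} \<subseteq> {x. ac_feasible two_bus x} // ?R"
      using ac_sol_feasible by (auto intro!: quotientI)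
  qed
  moreover have "?R `` {ac_sol (1/2)} \<noteq> ?R `` {ac_sol 2}"
  proof
    assume "?R `` {ac_sol (1/2)} = ?R `` {ac_sol 2}"
    hence "(ac_sol (1/2), ac_sol 2) \<in> ?R"
      using equiv_same_up_to_rotation by (metis eq_equiv_class_iff UNIV_I)
    hence "qg ((ac_sol (1/2))\<lparr>vang := vang (ac_sol 2)\<rparr>) 1 = qg (ac_sol 2) 1"
      by (auto simp: same_up_to_rotation_def)
    thus False by (simp add: ac_sol_def)
  qed
  ultimately show ?thesis by simp
qed

lemma ac_feasible_irrational:
  assumes "ac_feasible two_bus x"
  shows "\<not> ac_rational x"
proof
  assume "ac_rational x"
  hence v: "vmag x 2 \<in> \<rat>" by (simp add: ac_rational_def)
  \<comment> \<open>if \<open>|V\<^sub>2|\<^sup>2 = 1/2\<close>, it is \<open>2 |V\<^sub>2|\<close> whose square is \<open>2\<close>\<close>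
  hence "2 * vmag x 2 \<in> \<rat>" by simp
  from rational_square_neq_2 [OF v] rational_square_neq_2 [OF this] ac_feasible_vmag(2) [OF assms]
  show False by (auto simp: power_mult_distrib)
qed


section \<open>The minimizer of the Jabr relaxation\<close>

definition jabr_sol :: "(2, 1, 1) jabr_point" where
  "jabr_sol =
     \<lparr>pg = (\<lambda>_. 3 * sqrt 2), qg = (\<lambda>_. - 3/2),
      pkm = (\<lambda>_. 3 * sqrt 2), qkm = (\<lambda>_. - 3/2), pmk = (\<lambda>_. - 1), qmk = (\<lambda>_. 0),
      v2 = (\<lambda>k. if k = 1 then 3 * sqrt 2 else 1/2), cc = (\<lambda>_. 3/4), ss = (\<lambda>_. 3/4)\<rparr>"

lemma two_bus_jabr_feasible:
  "jabr_feasible two_bus x \<longleftrightarrow>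
     power_constraints two_bus x \<and>
     9/4 \<le> v2 x 1 \<and> v2 x 1 \<le> 9 \<and> 1/4 \<le> v2 x 2 \<and> v2 x 2 \<le> 9 \<and>
     pkm x 1 = v2 x 1 \<and> qkm x 1 = - (v2 x 2 + 1) \<and>
     cc x 1 = (v2 x 2 + 1) / 2 \<and> ss x 1 = (v2 x 2 + 1) / 2 \<and>
     (cc x 1)\<^sup>2 + (ss x 1)\<^sup>2 \<le> v2 x 1 * v2 x 2"
proof -
  have net: "src two_bus e = 1" "dst two_bus e = 2" "(vmin two_bus 1)\<^sup>2 = 9/4"
    "(vmin two_bus 2)\<^sup>2 = 1/4" "(vmax two_bus k)\<^sup>2 = 9" for e k
    by (simp_all add: two_bus_def power2_eq_square)
  have pm: "pmk x 1 = - 1" "qmk x 1 = 0" if "power_constraints two_bus x"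
    using that by (auto simp: two_bus_power_constraints)
  show ?thesis
    unfolding jabr_feasible_def forall_2 forall_1 Let_def net two_bus_flow
    using pm power_flow_solution [of "pkm x 1" "qkm x 1" "v2 x 1" "cc x 1" "ss x 1" "v2 x 2"]
    by auto
qed

lemma sqrt_2_bounds: "4/3 < sqrt 2" "sqrt 2 < 3/2"
  by (rule real_less_rsqrt, simp add: power_divide) (rule real_less_lsqrt, simp_all add: power_divide)

lemma jabr_sol_feasible: "jabr_feasible two_bus jabr_sol"
  using sqrt_2_bounds
  by (simp add: two_bus_jabr_feasible two_bus_power_constraints jabr_sol_def
      power_mult_distrib power_divide)

text \<open>
  A point that is at least as good has \<open>P\<^sup>2 \<ge> 18\<close>, while \<open>Q \<le> - 3/2\<close> gives \<open>Q\<^sup>2 \<ge> 9/4\<close>. The branch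
  limit \<open>81/4 = 18 + 9/4\<close> leaves room for neither to be strict, and \<open>P\<close> and \<open>Q\<close> determine the point.
\<close>

lemma jabr_sol_optimal:
  assumes feas: "jabr_feasible two_bus y" and le: "total_cost two_bus y \<le> total_cost two_bus jabr_sol"
  shows "y = jabr_sol"
proof -
  note feas = feas [unfolded two_bus_jabr_feasible two_bus_power_constraints]
  have p: "3 * sqrt 2 \<le> pg y 1" using le by (simp add: two_bus_cost jabr_sol_def)
  have "(3 * sqrt 2)\<^sup>2 \<le> (pg y 1)\<^sup>2" using p by (intro power_mono) auto
  hence P: "18 \<le> (pg y 1)\<^sup>2" by (simp add: power_mult_distrib)
  have "(3/2)\<^sup>2 \<le> (- qg y 1)\<^sup>2" using feas by (intro power_mono) auto
  hence Q: "9/4 \<le> (qg y 1)\<^sup>2" by (simp add: power_divide)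
  have "(pg y 1)\<^sup>2 + (qg y 1)\<^sup>2 \<le> 81/4" using feas by metis
  with P Q have "(pg y 1)\<^sup>2 = (3 * sqrt 2)\<^sup>2" "(- qg y 1)\<^sup>2 = (3/2)\<^sup>2"
    by (auto simp: power_mult_distrib power_divide)
  moreover have "0 \<le> pg y 1" "0 \<le> - qg y 1" using feas by auto
  ultimately have "pg y 1 = 3 * sqrt 2" "- qg y 1 = 3/2"
    using power2_eq_imp_eq [of "pg y 1" "3 * sqrt 2"] power2_eq_imp_eq [of "- qg y 1" "3/2"]
    by simp_all
  thus ?thesis using feas
    by (intro jabr_point.equality) (auto simp: jabr_sol_def fun_eq_iff forall_1 forall_2)
qed

lemma jabr_minimizer_iff: "jabr_minimizer two_bus x \<longleftrightarrow> x = jabr_sol"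
  using jabr_sol_feasible jabr_sol_optimal unfolding jabr_minimizer_def
  by (metis linorder_le_cases)

lemma jabr_sol_irrational: "\<not> jabr_rational jabr_sol"
proof
  assume "jabr_rational jabr_sol"
  hence "3 * sqrt 2 \<in> \<rat>" by (simp add: jabr_rational_def powers_rational_def jabr_sol_def)
  hence "3 * sqrt 2 / 3 \<in> \<rat>" by (intro Rats_divide) auto
  thus False using sqrt_2_irrational by simp
qed


section \<open>The maximizer of the dual\<close>

text \<open>
  With \<open>\<mu>\<close> the multiplier of the branch limit and \<open>\<nu>\<close> that of \<open>Q \<le> - 3/2\<close>, stationarity of
  \<open>- P + \<mu> (P\<^sup>2 + Q\<^sup>2 - 81/4) + \<nu> (Q + 3/2)\<close> at \<open>P = 3 sqrt 2\<close>, \<open>Q = - 3/2\<close> gives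
  \<open>6 sqrt 2 \<mu> = 1\<close> and \<open>\<nu> = 3 \<mu>\<close>. The multipliers of the balance at bus 1 carry the
  marginal cost \<open>- 1\<close> and the price \<open>\<nu>\<close> over from the generator to the line.
\<close>

definition dual_sol :: "(2, 1, 1) multipliers" where
  "dual_sol =
     \<lparr>m_pbal = (\<lambda>k. if k = 1 then - 1 else 0), m_qbal = (\<lambda>k. if k = 1 then sqrt 2 / 4 else 0),
      m_pkm = (\<lambda>_. 0), m_qkm = (\<lambda>_. 0), m_pmk = (\<lambda>_. 0), m_qmk = (\<lambda>_. 0),
      m_pmin = (\<lambda>_. 0), m_pmax = (\<lambda>_. 0), m_qmin = (\<lambda>_. 0), m_qmax = (\<lambda>_. sqrt 2 / 4),
      m_vmin = (\<lambda>_. 0), m_vmax = (\<lambda>_. 0),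
      m_ukm = (\<lambda>_. sqrt 2 / 12), m_umk = (\<lambda>_. 0), m_cone = (\<lambda>_. 0)\<rparr>"

text \<open>
  Complementary slackness for the cone: if \<open>x\<close> is an interior point, then \<open>x - t y\<close> is still in the
  cone for a small \<open>t > 0\<close>, and its inner product with \<open>y\<close> is \<open>- t |y|\<^sup>2\<close>.
\<close>

lemma dual_cone_interior_orthogonal:
  fixes y :: "real \<times> real \<times> real \<times> real"
  assumes y: "y \<in> dual_cone rotated_cone" and x: "x \<in> interior rotated_cone" and "x \<bullet> y = 0"
  shows "y = 0"
proof -
  obtain e where e: "0 < e" "cball x e \<subseteq> rotated_cone"
    using x by (meson mem_interior_cball)
  \<comment> \<open>the \<open>+ 1\<close> keeps \<open>t\<close> positive when \<open>y = 0\<close>\<close>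
  define t where "t = e / (norm y + 1)"
  have t: "0 < t" using e by (simp add: t_def add_nonneg_pos)
  have "t * norm y \<le> e" 
    unfolding t_def using e by (simp add: divide_le_eq add_nonneg_pos mult_left_mono)
  hence "x - t *\<^sub>R y \<in> rotated_cone" using t e by (auto simp: dist_norm)
  hence "0 \<le> (x - t *\<^sub>R y) \<bullet> y" using y by (simp add: dual_cone_def)
  hence "t * (y \<bullet> y) \<le> 0" using assms by (simp add: inner_diff_left)
  hence "y \<bullet> y \<le> 0" using t by (simp add: mult_le_0_iff)
  thus ?thesis by (metis inner_gt_zero_iff linorder_not_le)
qed

lemma interior_rotated_cone:
  assumes "0 < a" "0 < b" "c\<^sup>2 + s\<^sup>2 < a * b"
  shows "(a, b, c, s) \<in> interior rotated_cone"
proof -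
  let ?S = "{x :: real \<times> real \<times> real \<times> real. 0 < fst x} \<inter> {x. 0 < fst (snd x)} \<inter>
    {x. (fst (snd (snd x)))\<^sup>2 + (snd (snd (snd x)))\<^sup>2 < fst x * fst (snd x)}"
  have "open ?S"
    by (intro open_Int open_Collect_less continuous_intros)
  moreover have "?S \<subseteq> rotated_cone"
    by (auto simp: rotated_cone_def)
  ultimately show ?thesis
    using assms by (intro interiorI [of ?S]) auto
qed

lemma two_bus_lagrangian:
  "lagrangian two_bus l x =
     - pg x 1
     + m_pbal l 1 * (pkm x 1 - pg x 1) + m_qbal l 1 * (qkm x 1 - qg x 1)
     + m_pbal l 2 * (pmk x 1 + 1) + m_qbal l 2 * qmk x 1
     - m_pmin l 1 * pg x 1 + m_pmax l 1 * (pg x 1 - 10)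
     + m_qmin l 1 * (- 3 - qg x 1) + m_qmax l 1 * (qg x 1 + 3/2)
     + m_vmin l 1 * (9/4 - v2 x 1) + m_vmax l 1 * (v2 x 1 - 9)
     + m_vmin l 2 * (1/4 - v2 x 2) + m_vmax l 2 * (v2 x 2 - 9)
     + m_pkm l 1 * (pkm x 1 - (v2 x 1 - cc x 1 + ss x 1)) + m_qkm l 1 * (qkm x 1 + cc x 1 + ss x 1)
     + m_pmk l 1 * (pmk x 1 - (v2 x 2 - cc x 1 - ss x 1)) + m_qmk l 1 * (qmk x 1 + cc x 1 - ss x 1)
     + m_ukm l 1 * ((pkm x 1)\<^sup>2 + (qkm x 1)\<^sup>2 - 81/4)
     + m_umk l 1 * ((pmk x 1)\<^sup>2 + (qmk x 1)\<^sup>2 - 81/4)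
     - m_cone l 1 \<bullet> (v2 x 1, v2 x 2, cc x 1, ss x 1)"
proof -
  have net: "src two_bus e = 1" "dst two_bus e = 2" "(vmin two_bus 1)\<^sup>2 = 9/4"
    "(vmin two_bus 2)\<^sup>2 = 1/4" "(vmax two_bus k)\<^sup>2 = 9" "ulim two_bus e = ereal (81/4)"
    "pmin two_bus g = 0" "pmax two_bus g = 10" "qmin two_bus g = - 3" "qmax two_bus g = - 3/2"
    for e k g
    by (simp_all add: two_bus_def power2_eq_square)
  show ?thesis
    unfolding lagrangian_def Let_def sum_2 sum_1 two_bus_flow two_bus_mismatch two_bus_cost net
    by (simp add: algebra_simps)
qed

lemma dual_sol_feasible: "dual_feasible two_bus dual_sol"
  by (simp add: dual_feasible_def dual_sol_def dual_cone_def two_bus_def)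

text \<open>
  At the claimed maximizer the Lagrangian is a sum of squares plus the optimal value, so its
  infimum is the optimal value of the relaxation.
\<close>

lemma lagrangian_dual_sol:
  "lagrangian two_bus dual_sol x
     = sqrt 2 / 12 * ((pkm x 1 - 3 * sqrt 2)\<^sup>2 + (qkm x 1 + 3/2)\<^sup>2) - 3 * sqrt 2"
proof -
  have "sqrt 2 * sqrt 2 = 2" "sqrt 2 * (sqrt 2 * z) = 2 * z" for z :: real by simp_all
  thus ?thesis
    by (simp add: two_bus_lagrangian dual_sol_def power2_eq_square field_simps)
qed

lemma dual_function_dual_sol: "ereal (- 3 * sqrt 2) \<le> dual_function two_bus dual_sol"
  unfolding dual_function_def
  by (rule INF_greatest) (simp add: lagrangian_dual_sol)

lemma dual_function_le: "dual_function N l \<le> ereal (lagrangian N l x)"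
  unfolding dual_function_def by (rule INF_lower) simp

text \<open>
  At the primal optimum the equations and the two active inequalities contribute nothing; what
  remains is the optimal value minus the products of multipliers and slacks.
\<close>

lemma lagrangian_jabr_sol:
  "lagrangian two_bus l jabr_sol =
     - 3 * sqrt 2
     - (m_pmin l 1 * (3 * sqrt 2) + m_pmax l 1 * (10 - 3 * sqrt 2) + m_qmin l 1 * (3/2)
        + m_vmin l 1 * (3 * sqrt 2 - 9/4) + m_vmax l 1 * (9 - 3 * sqrt 2)
        + m_vmin l 2 * (1/4) + m_vmax l 2 * (17/2) + m_umk l 1 * (77/4)
        + (3 * sqrt 2, 1/2, 3/4, 3/4) \<bullet> m_cone l 1)"
  by (simp add: two_bus_lagrangian jabr_sol_def power_mult_distrib power_divide inner_commute
      algebra_simps)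

lemma slack_products_nonneg:
  assumes "dual_feasible two_bus l"
  shows "0 \<le> m_pmin l 1 * (3 * sqrt 2)" "0 \<le> m_pmax l 1 * (10 - 3 * sqrt 2)"
    "0 \<le> m_qmin l 1 * (3/2)" "0 \<le> m_vmin l 1 * (3 * sqrt 2 - 9/4)"
    "0 \<le> m_vmax l 1 * (9 - 3 * sqrt 2)" "0 \<le> m_vmin l 2 * (1/4)" "0 \<le> m_vmax l 2 * (17/2)"
    "0 \<le> m_umk l 1 * (77/4)" "0 \<le> (3 * sqrt 2, 1/2, 3/4, 3/4) \<bullet> m_cone l 1"
proof -
  have "(3 * sqrt 2, 1/2, 3/4, 3/4) \<in> rotated_cone"
    using sqrt_2_bounds by (simp add: rotated_cone_def power_divide)
  thus "0 \<le> (3 * sqrt 2, 1/2, 3/4, 3/4) \<bullet> m_cone l 1"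
    using assms by (auto simp: dual_feasible_def dual_cone_def simp del: inner_Pair)
qed (use assms sqrt_2_bounds in \<open>auto simp: dual_feasible_def intro!: mult_nonneg_nonneg\<close>)

lemma weak_duality:
  assumes "dual_feasible two_bus l"
  shows "lagrangian two_bus l jabr_sol \<le> - 3 * sqrt 2"
  using slack_products_nonneg [OF assms] unfolding lagrangian_jabr_sol by linarith

text \<open>
  The right-hand side of the assumption is the Lagrangian without the terms of the strict
  inequalities, as a function of free real variables: \<open>p\<close>, \<open>q\<close> generated, \<open>P\<close>, \<open>Q\<close> and \<open>P'\<close>, \<open>Q'\<close>
  flowing at the two ends of the line, and \<open>a\<close>, \<open>b\<close>, \<open>c\<close>, \<open>s\<close>. The lower bound is its value at the
  primal optimum, which is thus a global minimum, and all ten partial derivatives vanish there. The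
  multipliers solve the resulting nonsingular linear system.
\<close>

lemma stationary_multipliers:
  fixes \<kappa>p \<kappa>q \<kappa>p' \<kappa>q' \<nu> f g f' g' \<mu> :: real
  assumes below: "\<And>p q P Q P' Q' a b c s. - 3 * sqrt 2 \<le> - p + \<kappa>p * (P - p) + \<kappa>q * (Q - q)
     + \<kappa>p' * (P' + 1) + \<kappa>q' * Q' + \<nu> * (q + 3/2)
     + f * (P - (a - c + s)) + g * (Q + c + s) + f' * (P' - (b - c - s)) + g' * (Q' + c - s)
     + \<mu> * (P\<^sup>2 + Q\<^sup>2 - 81/4)"
  shows "\<kappa>p = - 1" "\<kappa>p' = 0" "\<kappa>q' = 0" "f = 0" "g = 0" "f' = 0" "g' = 0"
    "\<kappa>q = sqrt 2 / 4" "\<nu> = sqrt 2 / 4" "\<mu> = sqrt 2 / 12"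
proof -
  \<comment> \<open>the same inequality in displacements from the primal optimum\<close>
  have at_sol: "0 \<le> - p + \<kappa>p * (P - p) + \<kappa>q * (Q - q)
     + \<kappa>p' * P' + \<kappa>q' * Q' + \<nu> * q
     + f * (P - (a - c + s)) + g * (Q + c + s) + f' * (P' - (b - c - s)) + g' * (Q' + c - s)
     + \<mu> * (6 * sqrt 2 * P + P\<^sup>2 - 3 * Q + Q\<^sup>2)" for p q P Q P' Q' a b c s
    using below [of "3 * sqrt 2 + p" "3 * sqrt 2 + P" "- 3/2 + Q" "- 3/2 + q" "- 1 + P'" "Q'"
        "3 * sqrt 2 + a" "3/4 + c" "3/4 + s" "1/2 + b"]
    by (simp add: power2_sum power2_diff power_mult_distrib power_divide algebra_simps)
  have p: "- 1 - \<kappa>p = 0"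
    by (rule stationary_at_0 [where B = 0]) (use at_sol [of _ 0 0 0 0 0 0 0 0 0]
      in \<open>simp add: algebra_simps\<close>)
  have q: "\<nu> - \<kappa>q = 0"
    by (rule stationary_at_0 [where B = 0]) (use at_sol [of 0 0 0 _ 0 0 0 0 0 0]
      in \<open>simp add: algebra_simps\<close>)
  have P: "\<kappa>p + f + 6 * sqrt 2 * \<mu> = 0"
    by (rule stationary_at_0 [where B = \<mu>]) (use at_sol [of 0 _ 0 0 0 0 0 0 0 0]
      in \<open>simp add: algebra_simps\<close>)
  have Q: "\<kappa>q + g - 3 * \<mu> = 0"
    by (rule stationary_at_0 [where B = \<mu>]) (use at_sol [of 0 0 _ 0 0 0 0 0 0 0]
      in \<open>simp add: algebra_simps\<close>)
  have P': "\<kappa>p' + f' = 0"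
    by (rule stationary_at_0 [where B = 0]) (use at_sol [of 0 0 0 0 _ 0 0 0 0 0]
      in \<open>simp add: algebra_simps\<close>)
  have Q': "\<kappa>q' + g' = 0"
    by (rule stationary_at_0 [where B = 0]) (use at_sol [of 0 0 0 0 0 _ 0 0 0 0]
      in \<open>simp add: algebra_simps\<close>)
  have a: "- f = 0"
    by (rule stationary_at_0 [where B = 0]) (use at_sol [of 0 0 0 0 0 0 _ 0 0 0]
      in \<open>simp add: algebra_simps\<close>)
  have c: "f + g + f' + g' = 0"
    by (rule stationary_at_0 [where B = 0]) (use at_sol [of 0 0 0 0 0 0 0 _ 0 0]
      in \<open>simp add: algebra_simps\<close>)
  have s: "- f + g + f' - g' = 0"
    by (rule stationary_at_0 [where B = 0]) (use at_sol [of 0 0 0 0 0 0 0 0 _ 0]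
      in \<open>simp add: algebra_simps\<close>)
  have b: "- f' = 0"
    by (rule stationary_at_0 [where B = 0]) (use at_sol [of 0 0 0 0 0 0 0 0 0 _]
      in \<open>simp add: algebra_simps\<close>)
  show "\<kappa>p = - 1" "\<kappa>p' = 0" "\<kappa>q' = 0" "f = 0" "g = 0" "f' = 0" "g' = 0"
    using p P' Q' a b c s by linarith+
  have "sqrt 2 * \<mu> = 1/6" using p P a by simp
  hence "sqrt 2 * (sqrt 2 * \<mu>) = sqrt 2 / 6" by simp
  moreover have "sqrt 2 * (sqrt 2 * \<mu>) = 2 * \<mu>" by (simp flip: mult.assoc)
  ultimately show \<mu>: "\<mu> = sqrt 2 / 12" by simp
  show "\<kappa>q = sqrt 2 / 4" "\<nu> = sqrt 2 / 4"
    using \<mu> q Q a b c s by linarith+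
qed

text \<open>
  If the dual value of \<open>l\<close> reaches the primal optimal value, then weak duality holds with equality at
  the primal optimum. So every product of a multiplier and a slack is \<open>0\<close>, and the primal optimum
  minimizes the Lagrangian of \<open>l\<close>.
\<close>

lemma dual_sol_unique:
  assumes feas: "dual_feasible two_bus l" and opt: "ereal (- 3 * sqrt 2) \<le> dual_function two_bus l"
  shows "l = dual_sol"
proof -
  have below: "- 3 * sqrt 2 \<le> lagrangian two_bus l x" for x
    using order_trans [OF opt dual_function_le] by simp
  note slack_terms = slack_products_nonneg [OF feas] below [of jabr_sol, unfolded lagrangian_jabr_sol]
  have "m_pmin l 1 * (3 * sqrt 2) = 0" "m_pmax l 1 * (10 - 3 * sqrt 2) = 0"
    "m_qmin l 1 * (3/2) = 0" "m_vmin l 1 * (3 * sqrt 2 - 9/4) = 0"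
    "m_vmax l 1 * (9 - 3 * sqrt 2) = 0" "m_vmin l 2 * (1/4) = 0" "m_vmax l 2 * (17/2) = 0"
    "m_umk l 1 * (77/4) = 0" and orth: "(3 * sqrt 2, 1/2, 3/4, 3/4) \<bullet> m_cone l 1 = 0"
    using slack_terms by linarith+
  hence slack: "m_pmin l 1 = 0" "m_pmax l 1 = 0" "m_qmin l 1 = 0" "m_vmin l 1 = 0" "m_vmax l 1 = 0"
    "m_vmin l 2 = 0" "m_vmax l 2 = 0" "m_umk l 1 = 0"
    using sqrt_2_bounds by auto
  have "(3 * sqrt 2, 1/2, 3/4, 3/4) \<in> interior rotated_cone"
    using sqrt_2_bounds by (intro interior_rotated_cone) (auto simp: power_divide)
  hence cone: "m_cone l 1 = 0"
    using dual_cone_interior_orthogonal orth feas unfolding dual_feasible_def by blast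
  have "- 3 * sqrt 2 \<le> - p + m_pbal l 1 * (P - p) + m_qbal l 1 * (Q - q)
     + m_pbal l 2 * (P' + 1) + m_qbal l 2 * Q' + m_qmax l 1 * (q + 3/2)
     + m_pkm l 1 * (P - (a - c + s)) + m_qkm l 1 * (Q + c + s)
     + m_pmk l 1 * (P' - (b - c - s)) + m_qmk l 1 * (Q' + c - s)
     + m_ukm l 1 * (P\<^sup>2 + Q\<^sup>2 - 81/4)" for p q P Q P' Q' a b c s
    using below [of "\<lparr>pg = \<lambda>_. p, qg = \<lambda>_. q, pkm = \<lambda>_. P, qkm = \<lambda>_. Q, pmk = \<lambda>_. P',
      qmk = \<lambda>_. Q', v2 = (\<lambda>k. if k = 1 then a else b), cc = \<lambda>_. c, ss = \<lambda>_. s\<rparr>"]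
    by (simp add: two_bus_lagrangian slack cone)
  note free = stationary_multipliers [OF this]
  show ?thesis
    by (intro multipliers.equality)
      (simp_all add: dual_sol_def fun_eq_iff forall_1 forall_2 free slack cone)
qed

lemma dual_maximizer_iff: "dual_maximizer two_bus l \<longleftrightarrow> l = dual_sol"
proof
  assume "dual_maximizer two_bus l"
  hence "dual_feasible two_bus l" "dual_function two_bus dual_sol \<le> dual_function two_bus l"
    using dual_sol_feasible by (auto simp: dual_maximizer_def)
  thus "l = dual_sol" using dual_sol_unique dual_function_dual_sol order_trans by blast
next
  assume l: "l = dual_sol"
  have "dual_function two_bus l' \<le> dual_function two_bus dual_sol" if "dual_feasible two_bus l'" for l'
  proof -
    have "dual_function two_bus l' \<le> ereal (lagrangian two_bus l' jabr_sol)"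
      by (rule dual_function_le)
    also have "\<dots> \<le> ereal (- 3 * sqrt 2)" using weak_duality [OF that] by simp
    also have "\<dots> \<le> dual_function two_bus dual_sol" by (rule dual_function_dual_sol)
    finally show ?thesis .
  qed
  thus "dual_maximizer two_bus l" using dual_sol_feasible l by (simp add: dual_maximizer_def)
qed

lemma dual_sol_irrational: "\<not> multipliers_rational dual_sol"
proof
  assume "multipliers_rational dual_sol"
  hence "sqrt 2 / 4 \<in> \<rat>" by (simp add: multipliers_rational_def dual_sol_def)
  hence "4 * (sqrt 2 / 4) \<in> \<rat>" by (intro Rats_mult) auto
  thus False using sqrt_2_irrational by simp
qed

theorem proposition8:
  "\<exists>N :: (2, 1, 1) acopf.
     acopf_instance N \<and> (\<forall>e. standard_line N e) \<and> rational_data N \<and>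
     card ({x. ac_feasible N x} // same_up_to_rotation) = 2 \<and>
     (\<forall>x. ac_feasible N x \<longrightarrow> \<not> ac_rational x) \<and>
     (\<exists>!x. jabr_minimizer N x) \<and>
     (\<forall>x. jabr_minimizer N x \<longrightarrow> \<not> jabr_rational x) \<and>
     (\<exists>!l. dual_maximizer N l) \<and>
     (\<forall>l. dual_maximizer N l \<longrightarrow> \<not> multipliers_rational l)"
  using two_bus_instance two_bus_standard_line two_bus_rational_data card_ac_feasible
    ac_feasible_irrational jabr_sol_irrational dual_sol_irrational
  by (intro exI [of _ two_bus]) (simp add: jabr_minimizer_iff dual_maximizer_iff)

end
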